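(* Let $p\ge 1$, let $A:\mathcal D_A\to\mathbb R$ be a convex function with $\mathcal D_A\subset\mathbb R^p$ and image $Im(A)$, let $\mathcal T$ be a finite index set, and for each $\tau\in\mathcal T$ let $a_\tau\in\mathbb R$, $b_\tau\in\mathbb R^p$. Define $g_\tau(\lambda,\mu)=a_\tau\lambda-2\langle b_\tau,\mu\rangle$ and $$\mathcal G_{\mathcal T}=\{\tau\in\mathcal T \mid \exists(\lambda,\mu)\in Im(A)\times\mathcal D_A,\ \forall\tau'\in\mathcal T\text{ with }\tau'\ne\tau:\ g_\tau(\lambda,\mu)>g_{\tau'}(\lambda,\mu)\}.$$ For $\tau\in\mathcal T$ and $(\kappa,\lambda,\mu)\in\mathbb R\times\mathbb R\times\mathbb R^p$ let $h_\tau(\kappa,\lambda,\mu)=a_\tau\lambda-2\langle b_\tau,\mu\rangle-\kappa$ and $H_\tau=\{(\kappa,\lambda,\mu)\in\mathbb R^{p+2}\mid h_\tau(\kappa,\lambda,\mu)\le 0\}$. If $\tau\in\mathcal G_{\mathcal T}$, then: 1. there exists $(\kappa,\lambda,\mu)\in\mathbb R^{p+2}$ such that $h_\tau(\kappa,\lambda,\mu)=0$ and $h_{\tau'}(\kappa,\lambda,\mu)<0$ for all $\tau'\in\mathcal T$ with $\tau'\neq\tau$; 2. the equation $h_\tau(\kappa,\lambda,\mu)=0$ defines a supporting hyperplane of the set $\bigcap_{\tau'\in\mathcal T}H_{\tau'}$.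
   Context: $\langle\cdot,\cdot\rangle$ is the standard scalar product on $\mathbb R^p$. A supporting hyperplane of a set $C\subset\mathbb R^{p+2}$ is a hyperplane that meets $C$ and such that $C$ is contained in one of the two closed half-spaces it bounds. *)

theory Defs
  imports "HOL-Analysis.Analysis"
begin

text \<open>A pair \<open>(n, c)\<close> with \<open>n \<noteq> 0\<close> representing a hyperplane is unique up to a nonzero scalar, so
  the two closed half-spaces below do not depend on the chosen representation.\<close>

definition supporting_hyperplane :: "'a::euclidean_space set \<Rightarrow> 'a set \<Rightarrow> bool" where
  "supporting_hyperplane P C \<longleftrightarrow>
     (\<exists>n c. n \<noteq> 0 \<and> P = {x. n \<bullet> x = c} \<and> P \<inter> C \<noteq> {} \<and>
        (C \<subseteq> {x. n \<bullet> x \<le> c} \<or> C \<subseteq> {x. n \<bullet> x \<ge> c}))"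

definition g :: "('t \<Rightarrow> real) \<Rightarrow> ('t \<Rightarrow> real ^ 'p) \<Rightarrow> 't \<Rightarrow> real \<Rightarrow> real ^ 'p \<Rightarrow> real" where
  "g a b \<tau> l m = a \<tau> * l - 2 * (b \<tau> \<bullet> m)"

text \<open>The function \<open>A\<close> is total; only its values on the domain \<open>D\<close> matter, so that its image
  is \<open>A ` D\<close>. The two coordinates \<open>l\<close> and \<open>m\<close> range independently over \<open>A ` D\<close> and \<open>D\<close>.\<close>

definition \<G> ::
  "(real ^ 'p \<Rightarrow> real) \<Rightarrow> (real ^ 'p) set \<Rightarrow> 't set \<Rightarrow> ('t \<Rightarrow> real) \<Rightarrow> ('t \<Rightarrow> real ^ 'p) \<Rightarrow> 't set" where
  "\<G> A D T a b =
     {\<tau> \<in> T. \<exists>(l, m) \<in> (A ` D) \<times> D. \<forall>\<tau>' \<in> T. \<tau>' \<noteq> \<tau> \<longrightarrow> g a b \<tau> l m > g a b \<tau>' l m}"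

text \<open>The space of dimension \<open>p + 2\<close> is \<open>real \<times> real \<times> (real ^ 'p)\<close>, whose inner product in the
  library is the sum of the inner products of the components.\<close>

definition h ::
  "('t \<Rightarrow> real) \<Rightarrow> ('t \<Rightarrow> real ^ 'p) \<Rightarrow> 't \<Rightarrow> real \<times> real \<times> (real ^ 'p) \<Rightarrow> real" where
  "h a b \<tau> = (\<lambda>(k, l, m). a \<tau> * l - 2 * (b \<tau> \<bullet> m) - k)"

definition H ::
  "('t \<Rightarrow> real) \<Rightarrow> ('t \<Rightarrow> real ^ 'p) \<Rightarrow> 't \<Rightarrow> (real \<times> real \<times> (real ^ 'p)) set" where
  "H a b \<tau> = {x. h a b \<tau> x \<le> 0}"

end

theory Submission
  imports Defs
begin

text \<open>Since \<open>h a b \<tau>' (k, l, m)\<close> equals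
  \<open>g a b \<tau>' l m - k\<close>, taking \<open>k\<close> to be the strict maximum
  \<open>g a b \<tau> l m\<close> makes \<open>h\<close> vanish at \<tau> and negative at every
  other index. This point is where the hyperplane touches the intersection, which lies on one side
  of it because \<open>H a b \<tau>\<close> is one of the intersected half-spaces.\<close>

lemma h_eq_inner: "h a b \<tau> x = (- 1, a \<tau>, - 2 *\<^sub>R b \<tau>) \<bullet> x"
  by (cases x) (simp add: h_def inner_prod_def)

theorem theorem3:
  fixes A :: "real ^ 'p \<Rightarrow> real" and D :: "(real ^ 'p) set"
    and T :: "'t set" and a :: "'t \<Rightarrow> real" and b :: "'t \<Rightarrow> real ^ 'p" and \<tau> :: 't
  assumes "convex_on D A"
    and "finite T"
    and "\<tau> \<in> \<G> A D T a b"
  shows "(\<exists>x :: real \<times> real \<times> (real ^ 'p).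
            h a b \<tau> x = 0 \<and> (\<forall>\<tau>' \<in> T. \<tau>' \<noteq> \<tau> \<longrightarrow> h a b \<tau>' x < 0))
       \<and> supporting_hyperplane {x. h a b \<tau> x = 0} (\<Inter>\<tau>' \<in> T. H a b \<tau>')"
proof -
  from assms(3) obtain l m where "\<tau> \<in> T"
    and lm: "\<forall>\<tau>' \<in> T. \<tau>' \<noteq> \<tau> \<longrightarrow> g a b \<tau>' l m < g a b \<tau> l m"
    by (auto simp: \<G>_def)
  \<comment> \<open>Lift the strict maximiser \<open>(l, m)\<close> to the graph of \<open>g a b \<tau>\<close>.\<close>
  define x where "x = (g a b \<tau> l m, l, m)"
  have x: "h a b \<tau> x = 0" "\<forall>\<tau>' \<in> T. \<tau>' \<noteq> \<tau> \<longrightarrow> h a b \<tau>' x < 0"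
    using lm by (auto simp: x_def h_def g_def)
  \<comment> \<open>Membership in \<open>H a b \<tau>\<close> comes from the equality, in the others
    from the strict inequalities.\<close>
  then have "x \<in> {x. h a b \<tau> x = 0} \<inter> (\<Inter>\<tau>' \<in> T. H a b \<tau>')"
    by (force simp: H_def)
  moreover have "(\<Inter>\<tau>' \<in> T. H a b \<tau>') \<subseteq> {x. (- 1, a \<tau>, - 2 *\<^sub>R b \<tau>) \<bullet> x \<le> 0}"
    using \<open>\<tau> \<in> T\<close> by (auto simp: H_def h_eq_inner)
  \<comment> \<open>The coefficient -1 of \<open>k\<close> keeps the normal nonzero even when
    \<open>a \<tau>\<close> and \<open>b \<tau>\<close> vanish.\<close>
  moreover have "(- 1 :: real, a \<tau>, - 2 *\<^sub>R b \<tau>) \<noteq> 0"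
    by (simp add: zero_prod_def)
  ultimately have "supporting_hyperplane {x. h a b \<tau> x = 0} (\<Inter>\<tau>' \<in> T. H a b \<tau>')"
    unfolding supporting_hyperplane_def
    by (intro exI[of _ "(- 1, a \<tau>, - 2 *\<^sub>R b \<tau>)"] exI[of _ 0]) (auto simp: h_eq_inner)
  with x show ?thesis by blast
qed

end
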